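(* The statistics TMTI$_\infty$, tTMTI$_\infty$ and rtTMTI$_\infty$ all satisfy conditions (C1), (C2) and (C3). That is, let $k\ge1$ be an integer, let $\mathcal X=[0,1]$ and $F_{(j)}(x):=\beta(j,k+1-j)(x)$ for $j=1,\dots,k$ and $x\in[0,1]$. Then (C1) and (C2) hold for $F_{(1)},\dots,F_{(k)}$, and each of the three statistics (tTMTI$_\infty$ for any $\tau\in(0,1)$, rtTMTI$_\infty$ for any integer $1\le K<k$), computed from any $p$-values $p_1,\dots,p_k\in[0,1]$ with sorted values $p_{(1)}\le\dots\le p_{(k)}$, can be written as $h(F_{(1)}(p_{(1)}),\dots,F_{(k)}(p_{(k)}))$ for a function $h:[0,1]^k\to[0,1]$ satisfying (C3).
   Context: $\beta(a,b)(\cdot)$ denotes the CDF of the Beta$(a,b)$ distribution. Given $p_{(1)}\le\dots\le p_{(k)}$, put $Y_j:=\beta(j,k+1-j)(p_{(j)})$, $j=1,\dots,k$. The test statistics are: - TMTI$_\infty$: $\min(Y_1,\dots,Y_k)$; - tTMTI$_\infty$ with threshold $\tau\in(0,1)$: $\min(Y_1,\dots,Y_c)$ with $c=\max(\{j\in\{1,\dots,k\}:p_{(j)}\le\tau\}\cup\{1\})$; - rtTMTI$_\infty$ with integer $1\le K<k$: $\min(Y_1,\dots,Y_K)$. Conditions, for functions $F_{(1)},\dots,F_{(k)}:[0,1]\to\mathcal X\subseteq\mathbb R$ and $h:\mathcal X^k\to[0,1]$: (C1) $F_{(j)}(x)\le F_{(j)}(x+\epsilon)$ for all $j$ and all $\epsilon\ge0$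 with $x,x+\epsilon\in[0,1]$; (C2) $F_{(j)}(x)\ge F_{(j+1)}(x)$ for all $j\in\{1,\dots,k-1\}$ and $x\in[0,1]$; (C3) $h(\boldsymbol x)\le h(\boldsymbol x+\boldsymbol\epsilon)$ for all $\boldsymbol\epsilon\in[0,\infty)^k$ with $\boldsymbol x,\boldsymbol x+\boldsymbol\epsilon\in\mathcal X^k$. *)

theory Defs
  imports "HOL-Probability.Probability"
begin

definition beta_density :: "real \<Rightarrow> real \<Rightarrow> real \<Rightarrow> real" where
  "beta_density a b x =
     (if 0 < x \<and> x < 1 then x powr (a - 1) * (1 - x) powr (b - 1) / Beta a b else 0)"

definition beta_distribution :: "real \<Rightarrow> real \<Rightarrow> real measure" where
  "beta_distribution a b = density lborel (\<lambda>x. ennreal (beta_density a b x))"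

definition beta_cdf :: "real \<Rightarrow> real \<Rightarrow> real \<Rightarrow> real" where
  "beta_cdf a b = cdf (beta_distribution a b)"

(* The p-values are p 1, ..., p k; values of p outside {1..k} are irrelevant. *)
definition order_stat :: "nat \<Rightarrow> (nat \<Rightarrow> real) \<Rightarrow> nat \<Rightarrow> real" where
  "order_stat k p j = sort (map p [1..<Suc k]) ! (j - 1)"

definition order_cdf :: "nat \<Rightarrow> nat \<Rightarrow> real \<Rightarrow> real" where
  "order_cdf k j = beta_cdf (real j) (real k + 1 - real j)"

definition Y_stat :: "nat \<Rightarrow> (nat \<Rightarrow> real) \<Rightarrow> nat \<Rightarrow> real" where
  "Y_stat k p j = order_cdf k j (order_stat k p j)"

definition TMTI_inf :: "nat \<Rightarrow> (nat \<Rightarrow> real) \<Rightarrow> real" where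
  "TMTI_inf k p = Min (Y_stat k p ` {1..k})"

definition trunc_index :: "nat \<Rightarrow> real \<Rightarrow> (nat \<Rightarrow> real) \<Rightarrow> nat" where
  "trunc_index k \<tau> p = Max ({j \<in> {1..k}. order_stat k p j \<le> \<tau>} \<union> {1})"

definition tTMTI_inf :: "nat \<Rightarrow> real \<Rightarrow> (nat \<Rightarrow> real) \<Rightarrow> real" where
  "tTMTI_inf k \<tau> p = Min (Y_stat k p ` {1..trunc_index k \<tau> p})"

definition rtTMTI_inf :: "nat \<Rightarrow> nat \<Rightarrow> (nat \<Rightarrow> real) \<Rightarrow> real" where
  "rtTMTI_inf k K p = Min (Y_stat k p ` {1..K})"

definition cond_C1 :: "nat \<Rightarrow> (nat \<Rightarrow> real \<Rightarrow> real) \<Rightarrow> bool" where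
  "cond_C1 k F \<longleftrightarrow>
     (\<forall>j \<in> {1..k}. \<forall>x \<epsilon>. 0 \<le> \<epsilon> \<longrightarrow> x \<in> {0..1} \<longrightarrow> x + \<epsilon> \<in> {0..1} \<longrightarrow> F j x \<le> F j (x + \<epsilon>))"

definition cond_C2 :: "nat \<Rightarrow> (nat \<Rightarrow> real \<Rightarrow> real) \<Rightarrow> bool" where
  "cond_C2 k F \<longleftrightarrow> (\<forall>j \<in> {1..<k}. \<forall>x \<in> {0..1}. F (Suc j) x \<le> F j x)"

(* X^k is rendered as the extensional functions from {1..k} to X. *)
definition cond_C3 :: "nat \<Rightarrow> real set \<Rightarrow> ((nat \<Rightarrow> real) \<Rightarrow> real) \<Rightarrow> bool" where
  "cond_C3 k X h \<longleftrightarrow>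
     (\<forall>x \<in> {1..k} \<rightarrow>\<^sub>E X. \<forall>\<epsilon> \<in> {1..k} \<rightarrow>\<^sub>E {0..}.
        (\<lambda>j\<in>{1..k}. x j + \<epsilon> j) \<in> {1..k} \<rightarrow>\<^sub>E X \<longrightarrow>
        h x \<le> h (\<lambda>j\<in>{1..k}. x j + \<epsilon> j))"

(* The function h is fixed before the p-values are. *)
definition C3_representable ::
    "nat \<Rightarrow> real set \<Rightarrow> (nat \<Rightarrow> real \<Rightarrow> real) \<Rightarrow> ((nat \<Rightarrow> real) \<Rightarrow> real) \<Rightarrow> bool" where
  "C3_representable k X F T \<longleftrightarrow>
     (\<exists>h. h \<in> ({1..k} \<rightarrow>\<^sub>E X) \<rightarrow> {0..1} \<and> cond_C3 k X h \<and>
          (\<forall>p \<in> {1..k} \<rightarrow> {0..1}. T p = h (\<lambda>j\<in>{1..k}. F j (order_stat k p j))))"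

end

theory Submission
  imports Defs
begin

text \<open>
  For integer parameters the Beta distribution function is a binomial tail: on \<open>[0,1]\<close>,
  \<open>F\<^sub>j x = (\<Sum>i=j..k. B\<^sub>i x)\<close> with the Bernstein polynomials \<open>B\<^sub>i x = (k choose i) x^i (1-x)^(k-i)\<close>
  (the \<open>j\<close>-th smallest of \<open>k\<close> uniform variables is at most \<open>x\<close> iff at least \<open>j\<close> of them are).
  This follows from the fundamental theorem of calculus, because the derivatives of the
  \<open>B\<^sub>i\<close> telescope and leave exactly the Beta density (\<open>order_cdf_eq_sum_Bernstein\<close>). The tail formula
  gives everything about the \<open>F\<^sub>j\<close>: the bounds, since the \<open>B\<^sub>i\<close> are nonnegative with sum 1;
  (C2), since \<open>F\<^sub>j - F\<^sub>j\<^sub>+\<^sub>1 = B\<^sub>j \<ge> 0\<close>; and (C1), even strictly, since the derivative is positive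
  on \<open>(0,1)\<close>.

  Each statistic is a minimum \<open>min (Y\<^sub>1, \<dots>, Y\<^sub>n)\<close> over an initial segment. If the length \<open>n\<close> is a
  function of the vector \<open>Y\<close> that can only decrease when \<open>Y\<close> increases, then increasing \<open>Y\<close> takes
  the minimum of larger values over a smaller segment, so (C3) holds
  (\<open>C3_representable_Min_initial_segment\<close>). For the untruncated and the rank truncated statistic
  \<open>n\<close> is constant. For the threshold \<open>\<tau>\<close>, the truncation index is defined through the p-values and
  not through \<open>Y\<close>; here the strictness of (C1) is what matters, as it turns
  \<open>p\<^sub>(\<^sub>j\<^sub>) \<le> \<tau>\<close> into \<open>Y\<^sub>j \<le> F\<^sub>j \<tau>\<close>, a condition on \<open>Y\<close> that is lost as \<open>Y\<^sub>j\<close> grows.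
\<close>

section \<open>The Beta distribution function as a binomial tail\<close>

definition order_density :: "nat \<Rightarrow> nat \<Rightarrow> real \<Rightarrow> real" where
  "order_density k j x = real (j * (k choose j)) * x ^ (j - 1) * (1 - x) ^ (k - j)"

text \<open>Both terms of the product rule have the same shape, because
  \<open>(k - i) (k choose i) = (i + 1) (k choose (i + 1))\<close>.\<close>

lemma has_real_derivative_Bernstein:
  "(Bernstein k i has_real_derivative order_density k i x - order_density k (Suc i) x) (at x)"
proof -
  have "(k - i) * (k choose i) = Suc i * (k choose Suc i)"
    by (metis binomial_absorb_comp binomial_absorption mult.commute)
  then have absorb: "real (k - i) * real (k choose i) = real (Suc i) * real (k choose Suc i)"
    by (metis of_nat_mult)
  have "(Bernstein k i has_real_derivative
      real (k choose i) * (real i * x ^ (i - 1)) * (1 - x) ^ (k - i)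
      - (real (k - i) * real (k choose i)) * x ^ i * (1 - x) ^ (k - i - 1)) (at x)"
    unfolding Bernstein_def [abs_def]
    by (rule derivative_eq_intros refl | simp add: algebra_simps)+
  then show ?thesis
    unfolding absorb by (simp add: order_density_def algebra_simps)
qed

lemma has_real_derivative_sum_Bernstein:
  assumes "j \<le> k"
  shows "((\<lambda>x. \<Sum>i=j..k. Bernstein k i x) has_real_derivative order_density k j x) (at x)"
proof -
  have "((\<lambda>x. \<Sum>i=j..k. Bernstein k i x) has_real_derivative
      (\<Sum>i=j..k. order_density k i x - order_density k (Suc i) x)) (at x)"
    by (intro DERIV_sum has_real_derivative_Bernstein)
  also have "(\<Sum>i=j..k. order_density k i x - order_density k (Suc i) x)
      = order_density k j x - order_density k (Suc k) x"
    using sum_Suc_diff [of j k "\<lambda>i. - order_density k i x"] assms by simp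
  also have "order_density k (Suc k) x = 0"
    by (simp add: order_density_def binomial_eq_0 del: binomial_Suc_Suc of_nat_mult)
  finally show ?thesis by simp
qed

lemma beta_density_eq_order_density:
  assumes "1 \<le> j" "j \<le> k" "0 < x" "x < 1"
  shows "beta_density (real j) (real k + 1 - real j) x = order_density k j x"
proof -
  have Gammas: "Gamma (real j) = fact (j - 1)" "Gamma (real k + 1 - real j) = fact (k - j)"
    "Gamma (real k + 1) = fact k"
    using Gamma_fact [of "j - 1", where 'a = real] Gamma_fact [of "k - j", where 'a = real]
      Gamma_fact [of k, where 'a = real] assms
    by (simp_all add: of_nat_diff algebra_simps)
  have "fact j = real j * fact (j - 1)"
    using assms fact_reduce [of j, where 'a = real] by simp
  then have "1 / Beta (real j) (real k + 1 - real j) = real (j * (k choose j))"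
    using assms by (simp add: Beta_def Gammas binomial_fact)
  moreover have "x powr (real j - 1) = x ^ (j - 1)"
    using assms by (simp add: powr_realpow [symmetric] of_nat_diff)
  moreover have "(1 - x) powr (real k + 1 - real j - 1) = (1 - x) ^ (k - j)"
    using assms by (simp add: powr_realpow [symmetric] of_nat_diff)
  ultimately show ?thesis
    using assms by (simp add: beta_density_def order_density_def divide_inverse)
qed

theorem order_cdf_eq_sum_Bernstein:
  assumes j: "1 \<le> j" "j \<le> k" and x: "x \<in> {0..1}"
  shows "order_cdf k j x = (\<Sum>i=j..k. Bernstein k i x)"
proof -
  let ?f = "beta_density (real j) (real k + 1 - real j)"
  let ?G = "\<lambda>x. \<Sum>i=j..k. Bernstein k i x"
  have meas: "?f \<in> borel_measurable borel"
    unfolding beta_density_def [abs_def] by measurable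
  have "emeasure (beta_distribution (real j) (real k + 1 - real j)) {..x}
      = (\<integral>\<^sup>+y. ennreal (?f y) * indicator {..x} y \<partial>lborel)"
    unfolding beta_distribution_def using meas by (subst emeasure_density) simp_all
  \<comment> \<open>The Beta density is set to 0 at the endpoints, where the polynomial may be nonzero.\<close>
  also have "\<dots> = (\<integral>\<^sup>+y. ennreal (order_density k j y) * indicator {0..x} y \<partial>lborel)"
  proof (rule nn_integral_cong_AE)
    have "AE y in lborel. y \<noteq> (0::real)" "AE y in lborel. y \<noteq> (1::real)"
      by (rule AE_lborel_singleton)+
    then show "AE y in lborel. ennreal (?f y) * indicator {..x} y
        = ennreal (order_density k j y) * indicator {0..x} y"
    proof eventually_elim
      case (elim y)
      show ?case
      proof (cases "0 < y \<and> y < 1")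
        case True
        then show ?thesis
          using beta_density_eq_order_density [OF j] by (simp split: split_indicator)
      next
        case False
        then show ?thesis
          using elim x by (auto simp: beta_density_def split: split_indicator)
      qed
    qed
  qed
  also have "\<dots> = ?G x - ?G 0"
  proof (rule nn_integral_FTC_Icc)
    show "order_density k j \<in> borel_measurable borel"
      unfolding order_density_def [abs_def] by measurable
    show "(?G has_real_derivative order_density k j y) (at y)" for y
      by (rule has_real_derivative_sum_Bernstein [OF j(2)])
    show "0 \<le> order_density k j y" if "y \<in> {0..x}" for y
      using that x by (auto simp: order_density_def)
  qed (use x in auto)
  also have "?G 0 = 0"
    using j by (intro sum.neutral) (auto simp: Bernstein_def)
  finally have "emeasure (beta_distribution (real j) (real k + 1 - real j)) {..x} = ennreal (?G x)"
    by simp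
  moreover have "0 \<le> ?G x"
    using x by (intro sum_nonneg Bernstein_nonneg) auto
  ultimately show ?thesis
    by (simp add: order_cdf_def beta_cdf_def cdf_def measure_def)
qed

section \<open>Bounds and monotonicity of the order statistic distribution functions\<close>

lemma order_cdf_in_unit_interval:
  assumes j: "1 \<le> j" "j \<le> k" and x: "x \<in> {0..1}"
  shows "order_cdf k j x \<in> {0..1}"
proof -
  have nonneg: "0 \<le> Bernstein k i x" for i
    using x by (intro Bernstein_nonneg) auto
  then have "(\<Sum>i=j..k. Bernstein k i x) \<le> (\<Sum>i\<le>k. Bernstein k i x)"
    by (intro sum_mono2) auto
  then show ?thesis
    using nonneg by (simp add: order_cdf_eq_sum_Bernstein [OF assms] sum_nonneg)
qed

lemma strict_mono_on_order_cdf: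
  assumes j: "1 \<le> j" "j \<le> k"
  shows "strict_mono_on {0..1} (order_cdf k j)"
proof (rule strict_mono_onI)
  fix x y :: real
  assume xy: "x \<in> {0..1}" "y \<in> {0..1}" "x < y"
  let ?G = "\<lambda>x. \<Sum>i=j..k. Bernstein k i x"
  have "?G x < ?G y"
  proof (rule DERIV_pos_imp_increasing_open [OF xy(3)])
    fix z assume "x < z" "z < y"
    then have "0 < order_density k j z"
      using xy j by (simp add: order_density_def)
    then show "\<exists>d. (?G has_real_derivative d) (at z) \<and> 0 < d"
      using has_real_derivative_sum_Bernstein [OF j(2)] by blast
  next
    show "continuous_on {x..y} ?G"
      unfolding Bernstein_def by (intro continuous_intros)
  qed
  then show "order_cdf k j x < order_cdf k j y"
    using xy order_cdf_eq_sum_Bernstein [OF j] by simp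
qed

lemma order_cdf_le_iff:
  assumes "1 \<le> j" "j \<le> k" "x \<in> {0..1}" "y \<in> {0..1}"
  shows "order_cdf k j x \<le> order_cdf k j y \<longleftrightarrow> x \<le> y"
  using strict_mono_on_less_eq [OF strict_mono_on_order_cdf] assms by blast

lemma cond_C1_order_cdf: "cond_C1 k (order_cdf k)"
  unfolding cond_C1_def by (auto simp: order_cdf_le_iff)

lemma cond_C2_order_cdf: "cond_C2 k (order_cdf k)"
  unfolding cond_C2_def
proof (intro ballI)
  fix j and x :: real
  assume j: "j \<in> {1..<k}" and x: "x \<in> {0..1}"
  have "order_cdf k j x = Bernstein k j x + order_cdf k (Suc j) x"
    using j x by (simp add: order_cdf_eq_sum_Bernstein sum.atLeast_Suc_atMost)
  moreover have "0 \<le> Bernstein k j x"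
    using x by (intro Bernstein_nonneg) auto
  ultimately show "order_cdf k (Suc j) x \<le> order_cdf k j x"
    by simp
qed

section \<open>Minima over initial segments\<close>

lemma order_stat_in_unit_interval:
  assumes "p \<in> {1..k} \<rightarrow> {0..1}" "j \<in> {1..k}"
  shows "order_stat k p j \<in> {0..1}"
proof -
  have "sort (map p [1..<Suc k]) ! (j - 1) \<in> set (sort (map p [1..<Suc k]))"
    using assms(2) by (intro nth_mem) auto
  then show ?thesis
    unfolding order_stat_def using assms(1) by auto
qed

lemma Min_initial_segment_antimono:
  fixes x y :: "nat \<Rightarrow> 'a::linorder"
  assumes "1 \<le> m" "m \<le> n" "\<And>j. j \<in> {1..m} \<Longrightarrow> x j \<le> y j"
  shows "Min (x ` {1..n}) \<le> Min (y ` {1..m})"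
proof (rule Min.boundedI)
  fix a assume "a \<in> y ` {1..m}"
  then obtain j where j: "j \<in> {1..m}" "a = y j" by blast
  have "Min (x ` {1..n}) \<le> x j"
    using j(1) assms(2) by (intro Min_le) auto
  also have "\<dots> \<le> a"
    using assms(3) [OF j(1)] j(2) by simp
  finally show "Min (x ` {1..n}) \<le> a" .
qed (use assms in auto)

text \<open>The representing function is \<open>h y = min (y\<^sub>1, \<dots>, y\<^sub>n)\<close> with \<open>n = n y\<close>. It may not depend on the
  p-values, so the segment length has to be recovered from \<open>y\<close>; antitonicity of \<open>n\<close> is what (C3)
  needs, since a longer segment could only lower the minimum.\<close>

lemma C3_representable_Min_initial_segment:
  assumes F: "\<And>j x. j \<in> {1..k} \<Longrightarrow> x \<in> {0..1} \<Longrightarrow> F j x \<in> {0..1}"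
    and n: "\<And>y. 1 \<le> n y" "\<And>y. n y \<le> k"
    and anti: "\<And>x y. (\<And>j. j \<in> {1..k} \<Longrightarrow> x j \<le> y j) \<Longrightarrow> n y \<le> n x"
    and T: "\<And>p. p \<in> {1..k} \<rightarrow> {0..1} \<Longrightarrow>
      T p = Min ((\<lambda>j. F j (order_stat k p j)) ` {1..n (\<lambda>j\<in>{1..k}. F j (order_stat k p j))})"
  shows "C3_representable k {0..1} F T"
  unfolding C3_representable_def
proof (intro exI conjI ballI)
  let ?h = "\<lambda>y. Min (y ` {1..n y})"
  have sub: "{1..n y} \<subseteq> {1..k}" for y
    using n(2) [of y] by auto
  show "?h \<in> ({1..k} \<rightarrow>\<^sub>E {0..1}) \<rightarrow> {0..1}"
  proof
    fix y :: "nat \<Rightarrow> real"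
    assume y: "y \<in> {1..k} \<rightarrow>\<^sub>E {0..1}"
    have "?h y \<in> y ` {1..n y}"
      using n(1) [of y] by (intro Min_in) auto
    also have "y ` {1..n y} \<subseteq> {0..1}"
      using PiE_mem [OF y] sub [of y] by (intro image_subsetI) blast
    finally show "?h y \<in> {0..1}" .
  qed
  show "cond_C3 k {0..1} ?h"
    unfolding cond_C3_def
  proof (intro ballI impI)
    fix x \<epsilon> :: "nat \<Rightarrow> real"
    assume \<epsilon>: "\<epsilon> \<in> {1..k} \<rightarrow>\<^sub>E {0..}"
    let ?y = "\<lambda>j\<in>{1..k}. x j + \<epsilon> j"
    have le: "x j \<le> ?y j" if "j \<in> {1..k}" for j
      using PiE_mem [OF \<epsilon> that] that by simp
    show "?h x \<le> ?h ?y"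
    proof (rule Min_initial_segment_antimono)
      show "1 \<le> n ?y" by (rule n(1))
      show "n ?y \<le> n x" by (rule anti [OF le])
      show "x j \<le> ?y j" if "j \<in> {1..n ?y}" for j
        using that sub by (intro le) blast
    qed
  qed
  show "T p = ?h (\<lambda>j\<in>{1..k}. F j (order_stat k p j))" if p: "p \<in> {1..k} \<rightarrow> {0..1}" for p
  proof -
    let ?y = "\<lambda>j\<in>{1..k}. F j (order_stat k p j)"
    have "(\<lambda>j. F j (order_stat k p j)) ` {1..n ?y} = ?y ` {1..n ?y}"
      using sub [of ?y] by (intro image_cong) auto
    then show ?thesis
      by (simp add: T [OF p])
  qed
qed

lemma C3_representable_rtTMTI_inf:
  assumes "1 \<le> K" "K \<le> k"
  shows "C3_representable k {0..1} (order_cdf k) (rtTMTI_inf k K)"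
proof (rule C3_representable_Min_initial_segment [where n = "\<lambda>_. K"])
  show "order_cdf k j x \<in> {0..1}" if "j \<in> {1..k}" "x \<in> {0..1}" for j x
    using that by (intro order_cdf_in_unit_interval) auto
qed (use assms in \<open>simp_all add: rtTMTI_inf_def Y_stat_def\<close>)

lemma C3_representable_tTMTI_inf:
  assumes k: "1 \<le> k" and \<tau>: "\<tau> \<in> {0..1}"
  shows "C3_representable k {0..1} (order_cdf k) (tTMTI_inf k \<tau>)"
proof -
  define n where "n y = Max ({j \<in> {1..k}. y j \<le> order_cdf k j \<tau>} \<union> {1})" for y
  show ?thesis
  proof (rule C3_representable_Min_initial_segment [where n = n])
    show "order_cdf k j x \<in> {0..1}" if "j \<in> {1..k}" "x \<in> {0..1}" for j x
      using that by (intro order_cdf_in_unit_interval) auto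
    show "1 \<le> n y" for y
      unfolding n_def by (intro Max_ge) auto
    show "n y \<le> k" for y
      unfolding n_def using k by (intro Max.boundedI) auto
    show "n y \<le> n x" if le: "\<And>j. j \<in> {1..k} \<Longrightarrow> x j \<le> y j" for x y
      unfolding n_def using le by (intro Max_mono) (auto intro: order_trans)
    show "tTMTI_inf k \<tau> p = Min ((\<lambda>j. order_cdf k j (order_stat k p j)) `
        {1..n (\<lambda>j\<in>{1..k}. order_cdf k j (order_stat k p j))})"
      if p: "p \<in> {1..k} \<rightarrow> {0..1}" for p
    proof -
      have "{j \<in> {1..k}. order_stat k p j \<le> \<tau>} =
          {j \<in> {1..k}. (\<lambda>j\<in>{1..k}. order_cdf k j (order_stat k p j)) j \<le> order_cdf k j \<tau>}"
        using order_stat_in_unit_interval [OF p] \<tau>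
        by (intro Collect_cong conj_cong refl) (simp add: order_cdf_le_iff)
      then show ?thesis
        unfolding tTMTI_inf_def trunc_index_def n_def Y_stat_def by simp
    qed
  qed
qed

theorem theorem3:
  fixes k :: nat
  assumes "k \<ge> 1"
  shows "(\<forall>j \<in> {1..k}. order_cdf k j \<in> {0..1} \<rightarrow> {0..1})
    \<and> cond_C1 k (order_cdf k)
    \<and> cond_C2 k (order_cdf k)
    \<and> C3_representable k {0..1} (order_cdf k) (TMTI_inf k)
    \<and> (\<forall>\<tau> \<in> {0<..<1}. C3_representable k {0..1} (order_cdf k) (tTMTI_inf k \<tau>))
    \<and> (\<forall>K \<in> {1..<k}. C3_representable k {0..1} (order_cdf k) (rtTMTI_inf k K))"
proof (intro conjI ballI)
  show "order_cdf k j \<in> {0..1} \<rightarrow> {0..1}" if "j \<in> {1..k}" for j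
    using that order_cdf_in_unit_interval by (metis Pi_I atLeastAtMost_iff)
  show "cond_C1 k (order_cdf k)"
    by (rule cond_C1_order_cdf)
  show "cond_C2 k (order_cdf k)"
    by (rule cond_C2_order_cdf)
  have "TMTI_inf k = rtTMTI_inf k k"
    by (simp add: TMTI_inf_def [abs_def] rtTMTI_inf_def [abs_def])
  then show "C3_representable k {0..1} (order_cdf k) (TMTI_inf k)"
    using C3_representable_rtTMTI_inf assms by simp
  show "C3_representable k {0..1} (order_cdf k) (tTMTI_inf k \<tau>)" if "\<tau> \<in> {0<..<1}" for \<tau>
    using that assms by (intro C3_representable_tTMTI_inf) auto
  show "C3_representable k {0..1} (order_cdf k) (rtTMTI_inf k K)" if "K \<in> {1..<k}" for K
    using that by (intro C3_representable_rtTMTI_inf) auto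
qed

end
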